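(* Let $\mathcal{H}$ be a complex Hilbert space, let $A\in\mathcal{B}(\mathcal{H})$ be positive (semi-definite), let $\mathbb{A}=\begin{pmatrix}A&0\\0&A\end{pmatrix}$, and let $\mathbb{T}=\begin{pmatrix}P&Q\\R&S\end{pmatrix}$ with $P,Q,R,S\in\mathcal{B}_{A}(\mathcal{H})$. Then $$\omega_{\mathbb{A}}(\mathbb{T})\le\min\{\mu,\nu\},$$ where $$\mu=\sqrt{\min\{\|P+Q\|_A^2,\|P-Q\|_A^2\}+2\omega_A(PQ^{\sharp_A})}+\sqrt{\min\{\|R+S\|_A^2,\|R-S\|_A^2\}+2\omega_A(SR^{\sharp_A})}$$ and $$\nu=\sqrt{\min\{\|P+R\|_A^2,\|P-R\|_A^2\}+2\omega_A(P^{\sharp_A}R)}+\sqrt{\min\{\|Q+S\|_A^2,\|Q-S\|_A^2\}+2\omega_A(S^{\sharp_A}Q)}.$$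
   Context: $\mathcal{B}(\mathcal{H})$ is the algebra of bounded linear operators on $\mathcal{H}$. The positive semi-definite operator $A$ induces the semi-inner product $\langle x\mid y\rangle_A=\langle Ax\mid y\rangle$ and the seminorm $\|x\|_A=\langle x\mid x\rangle_A^{1/2}=\|A^{1/2}x\|$. An operator $T\in\mathcal{B}(\mathcal{H})$ is $A$-bounded if there is $\lambda>0$ with $\|Tx\|_A\le\lambda\|x\|_A$ for all $x\in\mathcal{H}$; then $\|T\|_A=\sup\{\|Tx\|_A : x\in\mathcal{H},\ \|x\|_A=1\}$. The $A$-numerical radius is $\omega_A(T)=\sup\{|\langle Tx\mid x\rangle_A| : x\in\mathcal{H},\ \|x\|_A=1\}$. $\mathcal{B}_A(\mathcal{H})$ is the set of $T\in\mathcal{B}(\mathcal{H})$ with $\mathcal{R}(T^*A)\subseteq\mathcal{R}(A)$ ($\mathcal{R}$ denotes range), equivalently those admitting an $A$-adjoint, i.e. a bounded $X$ with $AX=T^*A$; all such $T$ are $A$-bounded. For $T\in\mathcal{B}_A(\mathcal{H})$, $T^{\sharp_A}$ is the unique bounded solution $X$ of $AX=T^*A$ with $\mathcal{R}(X)\subseteq\overline{\mathcal{R}(A)}$. The operator $\mathbb{A}$ is a positive operator on $\mathcal{H}\oplus\mathcal{H}$, with $\langle x,y\rangle_{\mathbb{A}}=\langle x_1\mid y_1\rangle_A+\langle x_2\mid y_2\rangle_A$ for $x=(x_1,x_2)$, $y=(y_1,y_2)$; $\|\cdot\|_{\mathbb{A}}$ and $\omega_{\mathbb{A}}$ are defined in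 the same way with $(\mathcal{H}\oplus\mathcal{H},\mathbb{A})$ in place of $(\mathcal{H},A)$. A $2\times2$ matrix of operators on $\mathcal{H}$ denotes the corresponding operator on $\mathcal{H}\oplus\mathcal{H}$. *)

theory Defs
  imports "HOL-Analysis.Analysis"
begin

text \<open>
  The inner product is linear in its first argument. The real normed space structure is the one
  underlying the complex one, so that the topological notions of the library apply.
\<close>

class complex_inner = real_normed_vector +
  fixes scaleC :: "complex \<Rightarrow> 'a \<Rightarrow> 'a" (infixr "*\<^sub>C" 75)
    and cinner :: "'a \<Rightarrow> 'a \<Rightarrow> complex"
  assumes scaleC_add_right: "c *\<^sub>C (x + y) = c *\<^sub>C x + c *\<^sub>C y"
    and scaleC_add_left: "(c + d) *\<^sub>C x = c *\<^sub>C x + d *\<^sub>C x"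
    and scaleC_scaleC: "c *\<^sub>C d *\<^sub>C x = (c * d) *\<^sub>C x"
    and scaleR_scaleC: "r *\<^sub>R x = complex_of_real r *\<^sub>C x"
    and cinner_commute: "cinner x y = cnj (cinner y x)"
    and cinner_add_left: "cinner (x + y) z = cinner x z + cinner y z"
    and cinner_scaleC_left: "cinner (c *\<^sub>C x) y = c * cinner x y"
    and cinner_self_nonneg: "cinner x x \<in> \<real>\<^sub>\<ge>\<^sub>0"
    and cinner_eq_zero_iff: "cinner x x = 0 \<longleftrightarrow> x = 0"
    and norm_eq_sqrt_cinner: "norm x = sqrt (Re (cinner x x))"

class chilbert_space = complex_inner + complete_space

text \<open>
  The Hilbert space direct sum of two spaces is their product type; its norm is the library's
  Euclidean product norm.
\<close>

instantiation prod :: (complex_inner, complex_inner) complex_inner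
begin

definition scaleC_prod :: "complex \<Rightarrow> 'a \<times> 'b \<Rightarrow> 'a \<times> 'b"
  where "c *\<^sub>C x = (c *\<^sub>C fst x, c *\<^sub>C snd x)"

definition cinner_prod :: "'a \<times> 'b \<Rightarrow> 'a \<times> 'b \<Rightarrow> complex"
  where "cinner x y = cinner (fst x) (fst y) + cinner (snd x) (snd y)"

instance
proof
  fix c d :: complex and r :: real and x y z :: "'a \<times> 'b"
  have nn: "Re (cinner a a) \<ge> 0 \<and> Im (cinner a a) = 0" for a :: "'c::complex_inner"
    using cinner_self_nonneg[of a] by (simp add: complex_nonneg_Reals_iff)
  show "c *\<^sub>C (x + y) = c *\<^sub>C x + c *\<^sub>C y"
    by (simp add: scaleC_prod_def scaleC_add_right)
  show "(c + d) *\<^sub>C x = c *\<^sub>C x + d *\<^sub>C x"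
    by (simp add: scaleC_prod_def scaleC_add_left)
  show "c *\<^sub>C d *\<^sub>C x = (c * d) *\<^sub>C x"
    by (simp add: scaleC_prod_def scaleC_scaleC)
  show "r *\<^sub>R x = complex_of_real r *\<^sub>C x"
    by (simp add: scaleC_prod_def scaleR_prod_def scaleR_scaleC)
  show "cinner x y = cnj (cinner y x)"
    by (simp add: cinner_prod_def cinner_commute[symmetric])
  show "cinner (x + y) z = cinner x z + cinner y z"
    by (simp add: cinner_prod_def cinner_add_left)
  show "cinner (c *\<^sub>C x) y = c * cinner x y"
    by (simp add: cinner_prod_def scaleC_prod_def cinner_scaleC_left distrib_left)
  show "cinner x x \<in> \<real>\<^sub>\<ge>\<^sub>0"
    using cinner_self_nonneg[of "fst x"] cinner_self_nonneg[of "snd x"]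
    by (simp add: cinner_prod_def)
  show "cinner x x = 0 \<longleftrightarrow> x = 0"
  proof
    assume "cinner x x = 0"
    then have "Re (cinner (fst x) (fst x)) + Re (cinner (snd x) (snd x)) = 0"
      by (metis cinner_prod_def plus_complex.simps(1) zero_complex.simps(1))
    then have "cinner (fst x) (fst x) = 0" "cinner (snd x) (snd x) = 0"
      using nn[of "fst x"] nn[of "snd x"] by (auto simp: complex_eq_iff)
    then show "x = 0" by (simp add: cinner_eq_zero_iff prod_eq_iff)
  next
    assume "x = 0"
    then have "cinner (fst x) (fst x) = 0" "cinner (snd x) (snd x) = 0"
      unfolding cinner_eq_zero_iff by simp_all
    then show "cinner x x = 0"
      by (simp add: cinner_prod_def)
  qed
  show "norm x = sqrt (Re (cinner x x))"
    using nn[of "fst x"] nn[of "snd x"]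
    by (simp add: norm_prod_def cinner_prod_def norm_eq_sqrt_cinner)
qed

end

instance prod :: (chilbert_space, chilbert_space) chilbert_space ..

definition bounded_clinear :: "('a::complex_inner \<Rightarrow> 'b::complex_inner) \<Rightarrow> bool"
  where "bounded_clinear T \<longleftrightarrow> bounded_linear T \<and> (\<forall>c x. T (c *\<^sub>C x) = c *\<^sub>C T x)"

definition positive_op :: "('a::complex_inner \<Rightarrow> 'a) \<Rightarrow> bool"
  where "positive_op A \<longleftrightarrow> bounded_clinear A \<and> (\<forall>x. cinner (A x) x \<in> \<real>\<^sub>\<ge>\<^sub>0)"

text \<open>
  On a Hilbert space, a bounded operator has exactly one function with the property below.
\<close>

definition cadjoint :: "('a::complex_inner \<Rightarrow> 'b::complex_inner) \<Rightarrow> 'b \<Rightarrow> 'a"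
  where "cadjoint T = (THE S. \<forall>x y. cinner (T x) y = cinner x (S y))"

definition A_inner :: "('a::complex_inner \<Rightarrow> 'a) \<Rightarrow> 'a \<Rightarrow> 'a \<Rightarrow> complex"
  where "A_inner A x y = cinner (A x) y"

definition A_seminorm :: "('a::complex_inner \<Rightarrow> 'a) \<Rightarrow> 'a \<Rightarrow> real"
  where "A_seminorm A x = sqrt (Re (A_inner A x x))"

text \<open>
  The suprema below are taken in the nonnegative reals: \<open>insert 0\<close> only matters when no vector
  has \<open>A\<close>-seminorm 1 (that is, \<open>A = 0\<close>), where it yields 0 instead of the unspecified real
  \<open>Sup {}\<close>. The values are meaningful when \<open>T\<close> is \<open>A\<close>-bounded.
\<close>

definition A_opnorm :: "('a::complex_inner \<Rightarrow> 'a) \<Rightarrow> ('a \<Rightarrow> 'a) \<Rightarrow> real"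
  where "A_opnorm A T = Sup (insert 0 {A_seminorm A (T x) | x. A_seminorm A x = 1})"

definition A_numradius :: "('a::complex_inner \<Rightarrow> 'a) \<Rightarrow> ('a \<Rightarrow> 'a) \<Rightarrow> real"
  where "A_numradius A T = Sup (insert 0 {cmod (A_inner A (T x) x) | x. A_seminorm A x = 1})"

definition A_adjointable :: "('a::chilbert_space \<Rightarrow> 'a) \<Rightarrow> ('a \<Rightarrow> 'a) set"
  where "A_adjointable A = {T. bounded_clinear T \<and> range (cadjoint T \<circ> A) \<subseteq> range A}"

definition A_adjoint :: "('a::chilbert_space \<Rightarrow> 'a) \<Rightarrow> ('a \<Rightarrow> 'a) \<Rightarrow> 'a \<Rightarrow> 'a"
  where "A_adjoint A T =
    (THE X. bounded_clinear X \<and> A \<circ> X = cadjoint T \<circ> A \<and> range X \<subseteq> closure (range A))"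

definition op_matrix ::
    "('a::complex_inner \<Rightarrow> 'a) \<Rightarrow> ('a \<Rightarrow> 'a) \<Rightarrow> ('a \<Rightarrow> 'a) \<Rightarrow> ('a \<Rightarrow> 'a) \<Rightarrow> 'a \<times> 'a \<Rightarrow> 'a \<times> 'a"
  where "op_matrix P Q R S = (\<lambda>(x, y). (P x + Q y, R x + S y))"

end

theory Submission imports Defs begin

text \<open>
  Write \<open>\<parallel>\<cdot>\<parallel>\<close> and \<open>\<langle>\<cdot>, \<cdot>\<rangle>\<close> for the seminorm and semi-inner product of \<open>A\<close> and of the
  direct sum, and \<open>P\<^sup>#\<close> for the adjoint of \<open>P\<close> with respect to \<open>A\<close>. For a unit vector \<open>z = (x, y)\<close>,
  split \<open>\<langle>\<T>z, z\<rangle>\<close> according to the rows of the matrix. The first row contributes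
  \<open>\<langle>Px + Qy, x\<rangle>\<close>, the conjugate of \<open>\<langle>(P\<^sup>#x, Q\<^sup>#x), (x, y)\<rangle>\<close>, so by the Cauchy-Schwarz inequality
  in the direct sum its modulus is at most the square root of
  \<open>\<parallel>P\<^sup>#x\<parallel>\<^sup>2 + \<parallel>Q\<^sup>#x\<parallel>\<^sup>2\<close>. Now
  \<open>\<parallel>u\<parallel>\<^sup>2 + \<parallel>v\<parallel>\<^sup>2 = \<parallel>u \<plusminus> v\<parallel>\<^sup>2 \<minusplus> 2 Re \<langle>u, v\<rangle>\<close> for either choice of sign. With \<open>u = P\<^sup>#x\<close> and
  \<open>v = Q\<^sup>#x\<close> the square is at most the squared operator seminorm of \<open>P \<plusminus> Q\<close>, because an adjoint obeys
  every seminorm bound of its operator, and \<open>\<langle>Q\<^sup>#x, P\<^sup>#x\<rangle> = \<langle>PQ\<^sup>#x, x\<rangle>\<close> is controlled by the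
  numerical radius of \<open>PQ\<^sup>#\<close>. This is the first square root in \<open>\<mu>\<close>, and the second row gives the
  other one (\<open>row_inner_le\<close>). Splitting by columns instead, with \<open>(Px, Rx)\<close> and \<open>(Qy, Sy)\<close> in
  place of the adjoint vectors, gives \<open>\<nu>\<close> (\<open>column_inner_le\<close>).

  Two analytic facts carry this computation. First, \<open>P\<^sup>#\<close> must exist as a bounded operator
  (\<open>A_adjoint_pair_A_adjoint\<close>): solving \<open>AX = P\<^sup>*A\<close> pointwise inside the closure of the range of
  \<open>A\<close> gives a unique linear \<open>X\<close>, and \<open>\<langle>Xx | Az\<rangle> = \<langle>x | APz\<rangle>\<close> turns its boundedness into an
  application of the uniform boundedness principle to the functionals \<open>\<langle>\<cdot> | APz\<rangle>\<close> with
  \<open>Az\<close> in the unit ball. Second, the operators must be bounded in the seminorm, since a supremum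
  over an unbounded set of reals carries no information (\<open>A_adjoint_pair_A_bounded\<close>): \<open>P\<^sup>#P\<close> is
  bounded in norm and symmetric for \<open>\<langle>\<cdot>, \<cdot>\<rangle>\<close>, and Krein's iteration
  \<open>\<parallel>Wx\<parallel>\<^sup>2 \<le> \<parallel>W\<^sup>2x\<parallel> \<parallel>x\<parallel>\<close> bounds such a \<open>W\<close> in the seminorm.
\<close>

section \<open>Inner products and positive semidefinite forms\<close>

lemma scaleC_minus_one: "(-1) *\<^sub>C x = - (x::'a::complex_inner)"
  using scaleR_scaleC[of "-1" x] by simp

lemma cinner_add_right: "cinner (x::'a::complex_inner) (y + z) = cinner x y + cinner x z"
  by (metis cinner_commute cinner_add_left complex_cnj_add)

lemma cinner_scaleC_right: "cinner (x::'a::complex_inner) (c *\<^sub>C y) = cnj c * cinner x y"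
  by (metis cinner_commute cinner_scaleC_left complex_cnj_mult)

lemma cinner_minus_left: "cinner (- x) (y::'a::complex_inner) = - cinner x y"
  by (metis scaleC_minus_one cinner_scaleC_left mult_minus1)

lemma cinner_minus_right: "cinner x (- (y::'a::complex_inner)) = - cinner x y"
  by (metis cinner_commute cinner_minus_left complex_cnj_minus)

lemma cinner_diff_left: "cinner (x - y) (z::'a::complex_inner) = cinner x z - cinner y z"
  using cinner_add_left[of x "- y" z] by (simp add: cinner_minus_left)

lemma cinner_diff_right: "cinner (x::'a::complex_inner) (y - z) = cinner x y - cinner x z"
  using cinner_add_right[of x y "- z"] by (simp add: cinner_minus_right)

lemma cinner_zero_left [simp]: "cinner 0 (y::'a::complex_inner) = 0"
  using cinner_diff_left[of 0 0 y] by simp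

lemma cinner_zero_right [simp]: "cinner (y::'a::complex_inner) 0 = 0"
  using cinner_diff_right[of y 0 0] by simp

lemma cinner_self: "cinner x x = complex_of_real ((norm (x::'a::complex_inner))\<^sup>2)"
proof -
  have "Re (cinner x x) \<ge> 0" "Im (cinner x x) = 0"
    using cinner_self_nonneg[of x] by (simp_all add: complex_nonneg_Reals_iff)
  then show ?thesis by (simp add: complex_eq_iff norm_eq_sqrt_cinner)
qed

lemma cinner_ext:
  assumes "\<And>z. cinner z x = cinner z (y::'a::complex_inner)"
  shows "x = y"
proof -
  have "cinner (x - y) (x - y) = 0"
    using assms by (simp add: cinner_diff_right)
  then show ?thesis by (simp add: cinner_eq_zero_iff)
qed

lemma cnj_mult_self: "cnj c * c = (complex_of_real (cmod c))\<^sup>2"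
  using complex_norm_square[of c] by (simp add: mult.commute)

lemma norm_scaleC: "norm (c *\<^sub>C (x::'a::complex_inner)) = cmod c * norm x"
proof -
  have "complex_of_real ((norm (c *\<^sub>C x))\<^sup>2) = complex_of_real ((cmod c * norm x)\<^sup>2)"
    unfolding cinner_self[symmetric] cinner_scaleC_left cinner_scaleC_right
    by (simp add: cinner_self power_mult_distrib cnj_mult_self)
  then have "(norm (c *\<^sub>C x))\<^sup>2 = (cmod c * norm x)\<^sup>2"
    using of_real_eq_iff by blast
  then show ?thesis by (simp add: power2_eq_iff_nonneg)
qed

lemma bounded_clinearD:
  assumes "bounded_clinear T"
  shows "T (x + y) = T x + T y" "T (x - y) = T x - T y" "T (c *\<^sub>C x) = c *\<^sub>C T x" "T 0 = 0"
proof -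
  interpret bounded_linear T using assms by (simp add: bounded_clinear_def)
  show "T (x + y) = T x + T y" "T (x - y) = T x - T y" "T 0 = 0"
    by (simp_all add: add diff zero)
  show "T (c *\<^sub>C x) = c *\<^sub>C T x" using assms by (simp add: bounded_clinear_def)
qed

lemma bounded_clinearI:
  assumes "\<And>x y. T (x + y) = T x + T y" "\<And>c x. T (c *\<^sub>C x) = c *\<^sub>C T x"
    and "\<And>x. norm (T x) \<le> K * norm x"
  shows "bounded_clinear T"
  unfolding bounded_clinear_def
proof
  show "bounded_linear T"
    by (rule bounded_linear_intro[where K = K])
      (use assms in \<open>auto simp: scaleR_scaleC mult.commute\<close>)
qed (use assms in auto)

lemma bounded_clinear_compose:
  "bounded_clinear S \<Longrightarrow> bounded_clinear T \<Longrightarrow> bounded_clinear (\<lambda>x. S (T x))"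
  by (simp add: bounded_clinear_def bounded_linear_compose)

lemma bounded_clinear_add:
  "bounded_clinear S \<Longrightarrow> bounded_clinear T \<Longrightarrow> bounded_clinear (\<lambda>x. S x + T x)"
  by (simp add: bounded_clinear_def bounded_linear_add scaleC_add_right)

lemma scaleC_diff_right: "c *\<^sub>C (x - y) = c *\<^sub>C x - c *\<^sub>C (y::'a::complex_inner)"
  using scaleC_add_right[of c "x - y" y] by (simp add: algebra_simps)

lemma bounded_clinear_diff:
  "bounded_clinear S \<Longrightarrow> bounded_clinear T \<Longrightarrow> bounded_clinear (\<lambda>x. S x - T x)"
  by (simp add: bounded_clinear_def bounded_linear_sub scaleC_diff_right)

lemma positive_op_id: "positive_op (\<lambda>x::'a::complex_inner. x)"
  by (simp add: positive_op_def bounded_clinear_def bounded_linear_ident cinner_self_nonneg)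

context
  fixes A :: "'a::complex_inner \<Rightarrow> 'a"
  assumes A: "positive_op A"
begin

lemma A_clinear: "bounded_clinear A"
  using A by (simp add: positive_op_def)

lemma A_inner_add_left: "A_inner A (x + y) z = A_inner A x z + A_inner A y z"
  and A_inner_add_right: "A_inner A x (y + z) = A_inner A x y + A_inner A x z"
  and A_inner_diff_left: "A_inner A (x - y) z = A_inner A x z - A_inner A y z"
  and A_inner_diff_right: "A_inner A x (y - z) = A_inner A x y - A_inner A x z"
  and A_inner_scaleC_left: "A_inner A (c *\<^sub>C x) y = c * A_inner A x y"
  and A_inner_scaleC_right: "A_inner A x (c *\<^sub>C y) = cnj c * A_inner A x y"
  by (simp_all add: A_inner_def bounded_clinearD[OF A_clinear] cinner_add_left cinner_add_right
      cinner_diff_left cinner_diff_right cinner_scaleC_left cinner_scaleC_right)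

lemmas A_inner_simps = A_inner_add_left A_inner_add_right A_inner_diff_left A_inner_diff_right
  A_inner_scaleC_left A_inner_scaleC_right

lemma A_inner_self_real: "Im (A_inner A x x) = 0" and A_inner_self_nonneg: "0 \<le> Re (A_inner A x x)"
  using A by (simp_all add: positive_op_def A_inner_def complex_nonneg_Reals_iff)

lemma A_inner_self: "A_inner A x x = complex_of_real ((A_seminorm A x)\<^sup>2)"
  using A_inner_self_real[of x] A_inner_self_nonneg[of x]
  by (simp add: complex_eq_iff A_seminorm_def)

lemma A_seminorm_nonneg [simp]: "0 \<le> A_seminorm A x"
  by (simp add: A_seminorm_def A_inner_self_nonneg)

text \<open>A form with real values on the diagonal is Hermitian: polarize with \<open>x + y\<close> and
  \<open>\<i> x + y\<close>.\<close>

lemma A_inner_commute: "A_inner A x y = cnj (A_inner A y x)"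
proof -
  have "Im (A_inner A (x + y) (x + y)) = 0" "Im (A_inner A (\<i> *\<^sub>C x + y) (\<i> *\<^sub>C x + y)) = 0"
    by (rule A_inner_self_real)+
  then show ?thesis
    by (simp add: A_inner_simps A_inner_self_real complex_eq_iff)
qed

lemma positive_op_selfadjoint: "cinner (A x) y = cinner x (A y)"
  using A_inner_commute[of x y] cinner_commute[of x "A y"] by (simp add: A_inner_def)

text \<open>The usual discriminant argument, with the multiplier \<open>t\<langle>x, y\<rangle>\<^sub>A\<close>, \<open>t\<close> real. When the
  seminorm of \<open>y\<close> vanishes, the quadratic polynomial is affine and a large \<open>t\<close> makes it negative
  unless \<open>\<langle>x, y\<rangle>\<^sub>A = 0\<close>.\<close>

lemma A_Cauchy_Schwarz: "cmod (A_inner A x y) \<le> A_seminorm A x * A_seminorm A y"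
proof -
  define b where "b = A_inner A x y"
  define p where "p = (A_seminorm A x)\<^sup>2"
  define q where "q = (A_seminorm A y)\<^sup>2"
  have yx: "A_inner A y x = cnj b"
    unfolding b_def by (rule A_inner_commute)
  have poly: "0 \<le> p - 2 * t * (cmod b)\<^sup>2 + t\<^sup>2 * (cmod b)\<^sup>2 * q" for t :: real
  proof -
    define k where "k = complex_of_real t * b"
    have "A_inner A (x - k *\<^sub>C y) (x - k *\<^sub>C y) = p - cnj k * b - k * cnj b + k * cnj k * q"
      unfolding A_inner_simps
      by (simp add: A_inner_self yx b_def[symmetric] p_def q_def algebra_simps)
    also have "\<dots> = complex_of_real p - 2 * t * (cnj b * b) + t\<^sup>2 * (cnj b * b) * q"
      by (simp add: k_def algebra_simps power2_eq_square)
    also have "\<dots> = complex_of_real (p - 2 * t * (cmod b)\<^sup>2 + t\<^sup>2 * (cmod b)\<^sup>2 * q)"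
      by (simp add: cnj_mult_self)
    finally show ?thesis
      using A_inner_self_nonneg[of "x - k *\<^sub>C y"] by (metis Re_complex_of_real)
  qed
  have "(cmod b)\<^sup>2 \<le> p * q"
  proof (cases "q = 0")
    case True
    have "cmod b = 0"
    proof (rule ccontr)
      assume "cmod b \<noteq> 0"
      then show False
        using poly[of "(p + 1) / (2 * (cmod b)\<^sup>2)"] True by (simp add: field_simps)
    qed
    then show ?thesis by (simp add: True)
  next
    case False
    then have "q > 0" by (simp add: q_def)
    moreover have "0 \<le> p - (cmod b)\<^sup>2 / q"
      using poly[of "1 / q"] False by (simp add: field_simps power2_eq_square)
    ultimately show ?thesis by (simp add: field_simps)
  qed
  then have "(cmod b)\<^sup>2 \<le> (A_seminorm A x * A_seminorm A y)\<^sup>2"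
    by (simp add: p_def q_def power_mult_distrib)
  then show ?thesis unfolding b_def by (rule power2_le_imp_le) simp
qed

lemma A_seminorm_scaleC: "A_seminorm A (c *\<^sub>C x) = cmod c * A_seminorm A x"
proof -
  have "complex_of_real ((A_seminorm A (c *\<^sub>C x))\<^sup>2) = complex_of_real ((cmod c * A_seminorm A x)\<^sup>2)"
    unfolding A_inner_self[symmetric] A_inner_scaleC_left A_inner_scaleC_right
    by (simp add: A_inner_self power_mult_distrib cnj_mult_self)
  then have "(A_seminorm A (c *\<^sub>C x))\<^sup>2 = (cmod c * A_seminorm A x)\<^sup>2"
    using of_real_eq_iff by blast
  then show ?thesis by (simp add: power2_eq_iff_nonneg)
qed

end

lemma A_seminorm_id: "A_seminorm (\<lambda>x. x) x = norm (x::'a::complex_inner)"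
  by (simp add: A_seminorm_def A_inner_def norm_eq_sqrt_cinner)

lemma Cauchy_Schwarz: "cmod (cinner x y) \<le> norm x * norm (y::'a::complex_inner)"
  using A_Cauchy_Schwarz[OF positive_op_id, of x y] by (simp add: A_seminorm_id A_inner_def)

lemma bounded_linear_cinner_left: "bounded_linear (\<lambda>x. cinner x (y::'a::complex_inner))"
proof (rule bounded_linear_intro[where K = "norm y"])
  show "cinner (r *\<^sub>R x) y = r *\<^sub>R cinner x y" for r x
    by (simp add: scaleR_scaleC cinner_scaleC_left scaleR_conv_of_real)
qed (auto simp: cinner_add_left Cauchy_Schwarz)

lemma bounded_linear_cinner_right: "bounded_linear (\<lambda>x. cinner (y::'a::complex_inner) x)"
proof (rule bounded_linear_intro[where K = "norm y"])
  show "cinner y (r *\<^sub>R x) = r *\<^sub>R cinner y x" for r x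
    by (simp add: scaleR_scaleC cinner_scaleC_right scaleR_conv_of_real)
qed (auto simp: cinner_add_right Cauchy_Schwarz mult.commute[of "norm y"] intro: order_trans[OF Cauchy_Schwarz])

lemma A_seminorm_le_norm:
  fixes A :: "'a::complex_inner \<Rightarrow> 'a"
  assumes "positive_op A"
  obtains C where "C \<ge> 0" "\<And>x. A_seminorm A x \<le> C * norm x"
proof -
  have "bounded_linear A" using assms by (simp add: positive_op_def bounded_clinear_def)
  then obtain K where K: "0 \<le> K" "\<And>x. norm (A x) \<le> norm x * K"
    using bounded_linear.nonneg_bounded by blast
  have "A_seminorm A x \<le> sqrt K * norm x" for x
  proof -
    have "Re (A_inner A x x) \<le> norm (A x) * norm x"
      unfolding A_inner_def using Cauchy_Schwarz complex_Re_le_cmod order_trans by blast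
    also have "\<dots> \<le> K * (norm x)\<^sup>2"
      using mult_right_mono[OF K(2), of "norm x" x] by (simp add: power2_eq_square mult_ac)
    finally have "A_seminorm A x \<le> sqrt (K * (norm x)\<^sup>2)"
      by (simp add: A_seminorm_def)
    then show ?thesis by (simp add: real_sqrt_mult)
  qed
  then show ?thesis using K(1) by (intro that[of "sqrt K"]) auto
qed

section \<open>Orthogonal projection and the Riesz representation\<close>

lemma parallelogram:
  "(norm (x + y))\<^sup>2 + (norm (x - y))\<^sup>2 = 2 * (norm x)\<^sup>2 + 2 * (norm (y::'a::complex_inner))\<^sup>2"
proof -
  have "complex_of_real ((norm (x + y))\<^sup>2 + (norm (x - y))\<^sup>2)
      = complex_of_real (2 * (norm x)\<^sup>2 + 2 * (norm y)\<^sup>2)"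
    unfolding of_real_add of_real_mult cinner_self[symmetric]
    by (simp add: cinner_add_left cinner_add_right cinner_diff_left cinner_diff_right)
  then show ?thesis using of_real_eq_iff by blast
qed

lemma minimal_imp_orthogonal:
  fixes w v :: "'a::complex_inner"
  assumes "\<And>c. norm w \<le> norm (w - c *\<^sub>C v)"
  shows "cinner w v = 0"
proof (cases "v = 0")
  case False
  then have v: "norm v > 0" by simp
  \<comment> \<open>The choice for which \<open>c v\<close> is the projection of \<open>w\<close> onto the line through \<open>v\<close>.\<close>
  define c where "c = cinner w v / (norm v)\<^sup>2"
  have vw: "cinner v w = cnj (cinner w v)" by (rule cinner_commute)
  have "complex_of_real ((norm (w - c *\<^sub>C v))\<^sup>2)
      = complex_of_real ((norm w)\<^sup>2) - cnj c * cinner w v - c * cnj (cinner w v) + c * cnj c * (norm v)\<^sup>2"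
    unfolding cinner_self[symmetric]
    by (simp add: cinner_diff_left cinner_diff_right cinner_scaleC_left cinner_scaleC_right vw
        cinner_self[of v] algebra_simps)
  also have "\<dots> = complex_of_real ((norm w)\<^sup>2) - cinner w v * cnj (cinner w v) / (norm v)\<^sup>2"
    using v by (simp add: c_def field_simps power2_eq_square)
  also have "\<dots> = complex_of_real ((norm w)\<^sup>2 - (cmod (cinner w v))\<^sup>2 / (norm v)\<^sup>2)"
    by (simp only: complex_norm_square of_real_diff of_real_divide)
  finally have "(norm (w - c *\<^sub>C v))\<^sup>2 = (norm w)\<^sup>2 - (cmod (cinner w v))\<^sup>2 / (norm v)\<^sup>2"
    using of_real_eq_iff by blast
  moreover have "(norm w)\<^sup>2 \<le> (norm (w - c *\<^sub>C v))\<^sup>2"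
    using assms by (intro power_mono) auto
  ultimately have "(cmod (cinner w v))\<^sup>2 / (norm v)\<^sup>2 \<le> 0" by linarith
  then show ?thesis using v by (simp add: divide_le_0_iff)
qed simp

definition csubspace :: "'a::complex_inner set \<Rightarrow> bool"
  where "csubspace V \<longleftrightarrow> 0 \<in> V \<and> (\<forall>x\<in>V. \<forall>y\<in>V. x + y \<in> V) \<and> (\<forall>c. \<forall>x\<in>V. c *\<^sub>C x \<in> V)"

text \<open>A sequence in \<open>V\<close> whose distances to \<open>x\<close> tend to the infimum is Cauchy, by the parallelogram
  law and because midpoints stay in \<open>V\<close>; its limit is the foot of the perpendicular.\<close>

lemma orthogonal_projection_exists:
  fixes x :: "'a::chilbert_space"
  assumes V: "csubspace V" "closed V"
  obtains y where "y \<in> V" "\<And>v. v \<in> V \<Longrightarrow> cinner (x - y) v = 0"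
proof -
  have ne: "V \<noteq> {}" and V0: "0 \<in> V" using V by (auto simp: csubspace_def)
  have VR: "r *\<^sub>R v \<in> V" if "v \<in> V" for r v
    using V that by (simp add: csubspace_def scaleR_scaleC)
  define d where "d = infdist x V"
  have dle: "d \<le> norm (x - v)" if "v \<in> V" for v
    using infdist_le[OF that, of x] by (simp add: d_def dist_norm)
  have d0: "0 \<le> d" by (simp add: d_def infdist_nonneg)
  have "\<exists>v\<in>V. norm (x - v) < d + e" if "e > 0" for e
  proof -
    have "Inf (dist x ` V) < d + e" using that ne by (simp add: d_def infdist_notempty)
    then show ?thesis using cInf_lessD[of "dist x ` V"] ne by (auto simp: dist_norm)
  qed
  then have "\<forall>n. \<exists>v\<in>V. norm (x - v) < d + 1 / real (Suc n)" by simp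
  then obtain s where s: "\<And>n. s n \<in> V" "\<And>n. norm (x - s n) < d + 1 / real (Suc n)" by metis
  have diff: "(norm (s m - s n))\<^sup>2 \<le> 4 * (2 * d + 1) * e"
    if e: "1 / real (Suc m) \<le> e" "1 / real (Suc n) \<le> e" "e \<le> 1" "e > 0" for m n e
  proof -
    have mid: "(1/2) *\<^sub>R (s m + s n) \<in> V" using s V VR by (simp add: csubspace_def)
    have "(x - s n) + (x - s m) = 2 *\<^sub>R (x - (1/2) *\<^sub>R (s m + s n))"
      by (simp add: algebra_simps scaleR_2)
    then have "norm ((x - s n) + (x - s m)) = 2 * norm (x - (1/2) *\<^sub>R (s m + s n))" by simp
    then have "2 * d \<le> norm ((x - s n) + (x - s m))" using dle[OF mid] by simp
    then have l: "4 * d\<^sup>2 \<le> (norm ((x - s n) + (x - s m)))\<^sup>2"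
      using power_mono[of "2 * d" _ 2] d0 by (simp add: power_mult_distrib)
    have b: "(norm (x - s k))\<^sup>2 \<le> (d + e)\<^sup>2" if "1 / real (Suc k) \<le> e" for k
    proof (rule power_mono)
      show "norm (x - s k) \<le> d + e" using s(2)[of k] that by linarith
    qed simp
    have "(norm (s m - s n))\<^sup>2 \<le> 4 * (d + e)\<^sup>2 - 4 * d\<^sup>2"
      using parallelogram[of "x - s n" "x - s m"] l b[OF e(1)] b[OF e(2)] by simp
    also have "\<dots> = 4 * (2 * d + e) * e" by (simp add: power2_eq_square algebra_simps)
    also have "\<dots> \<le> 4 * (2 * d + 1) * e" using e by (intro mult_right_mono) auto
    finally show ?thesis .
  qed
  have "Cauchy s"
  proof (rule metric_CauchyI)
    fix r :: real assume r: "r > 0"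
    \<comment> \<open>The second argument of the minimum makes the bound in \<open>diff\<close> at most half of \<open>r\<^sup>2\<close>.\<close>
    define e where "e = min 1 (r\<^sup>2 / (8 * (2 * d + 1)))"
    have e: "e > 0" "e \<le> 1" using r d0 by (auto simp: e_def)
    have "4 * (2 * d + 1) * e \<le> 4 * (2 * d + 1) * (r\<^sup>2 / (8 * (2 * d + 1)))"
      using d0 by (intro mult_left_mono) (auto simp: e_def)
    also have "\<dots> = r\<^sup>2 / 2" using d0 by (simp add: field_simps)
    also have "\<dots> < r\<^sup>2" using r by simp
    finally have er: "4 * (2 * d + 1) * e < r\<^sup>2" .
    obtain N where N: "inverse (real (Suc N)) < e" using reals_Archimedean e(1) by blast
    have small: "1 / real (Suc m) \<le> e" if "m \<ge> N" for m
    proof -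
      have "1 / real (Suc m) \<le> 1 / real (Suc N)" using that by (intro divide_left_mono) auto
      then show ?thesis using N by (simp add: inverse_eq_divide)
    qed
    have "dist (s m) (s n) < r" if "m \<ge> N" "n \<ge> N" for m n
    proof -
      have "(norm (s m - s n))\<^sup>2 < r\<^sup>2"
        using diff[OF small[OF that(1)] small[OF that(2)] e(2,1)] er by linarith
      then show ?thesis
        unfolding dist_norm by (rule power2_less_imp_less) (use r in simp)
    qed
    then show "\<exists>M. \<forall>m\<ge>M. \<forall>n\<ge>M. dist (s m) (s n) < r" by blast
  qed
  then obtain y where y: "s \<longlonglongrightarrow> y" using Cauchy_convergent convergent_def by blast
  have yV: "y \<in> V" using closed_sequentially[OF V(2)] s(1) y by blast
  have "(\<lambda>n. norm (x - s n)) \<longlonglongrightarrow> norm (x - y)" using y by (intro tendsto_intros)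
  moreover have "(\<lambda>n. d + 1 / real (Suc n)) \<longlonglongrightarrow> d + 0"
    by (intro tendsto_intros) (use LIMSEQ_inverse_real_of_nat in \<open>simp add: inverse_eq_divide\<close>)
  ultimately have "norm (x - y) \<le> d + 0"
    by (rule LIMSEQ_le) (intro exI allI impI less_imp_le s(2))
  then have min: "norm (x - y) \<le> d" by simp
  have "cinner (x - y) v = 0" if "v \<in> V" for v
  proof (rule minimal_imp_orthogonal)
    fix c
    have "y + c *\<^sub>C v \<in> V" using V yV that by (simp add: csubspace_def)
    from dle[OF this] min show "norm (x - y) \<le> norm (x - y - c *\<^sub>C v)"
      by (simp add: algebra_simps)
  qed
  then show ?thesis using that yV by blast
qed

text \<open>The representing vector is a multiple of a vector \<open>w\<close> orthogonal to the kernel, since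
  \<open>f w \<cdot> x - f x \<cdot> w\<close> always lies in the kernel.\<close>

lemma Riesz_representation:
  fixes f :: "'a::chilbert_space \<Rightarrow> complex"
  assumes f: "bounded_linear f" and fC: "\<And>c x. f (c *\<^sub>C x) = c * f x"
  obtains y where "\<And>x. f x = cinner x y"
proof (cases "\<forall>x. f x = 0")
  case True
  then show ?thesis using that[of 0] by simp
next
  case False
  then obtain z where z: "f z \<noteq> 0" by blast
  interpret bounded_linear f by (rule f)
  define V where "V = {x. f x = 0}"
  have V: "csubspace V" by (simp add: V_def csubspace_def add zero fC)
  have "closed V" unfolding V_def
    by (intro closed_Collect_eq linear_continuous_on f continuous_on_const)
  then obtain p where p: "p \<in> V" "\<And>v. v \<in> V \<Longrightarrow> cinner (z - p) v = 0"
    using orthogonal_projection_exists[OF V] by blast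
  define w where "w = z - p"
  have fw: "f w \<noteq> 0" using z p(1) by (simp add: w_def V_def diff)
  then have w0: "cinner w w \<noteq> 0" using zero by (auto simp: cinner_eq_zero_iff)
  have "f x = cinner x (cnj (f w / cinner w w) *\<^sub>C w)" for x
  proof -
    have "f w *\<^sub>C x - f x *\<^sub>C w \<in> V" by (simp add: V_def diff fC)
    then have "cinner w (f w *\<^sub>C x - f x *\<^sub>C w) = 0" using p(2) by (simp add: w_def)
    then have "cinner (f w *\<^sub>C x - f x *\<^sub>C w) w = 0"
      by (metis cinner_commute complex_cnj_zero)
    then have "f w * cinner x w = f x * cinner w w"
      by (simp add: cinner_diff_left cinner_scaleC_left)
    then show ?thesis using w0 by (simp add: cinner_scaleC_right field_simps)
  qed
  then show ?thesis using that by blast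
qed

lemma cinner_cadjoint:
  fixes T :: "'a::chilbert_space \<Rightarrow> 'b::complex_inner"
  assumes T: "bounded_clinear T"
  shows "cinner (T x) y = cinner x (cadjoint T y)"
proof -
  have "\<exists>s. \<forall>x. cinner (T x) y = cinner x s" for y
  proof -
    have "bounded_linear (\<lambda>x. cinner (T x) y)"
      using T by (intro bounded_linear_compose[OF bounded_linear_cinner_left])
        (simp add: bounded_clinear_def)
    moreover have "cinner (T (c *\<^sub>C x)) y = c * cinner (T x) y" for c x
      by (simp add: bounded_clinearD[OF T] cinner_scaleC_left)
    ultimately obtain s where "\<And>x. cinner (T x) y = cinner x s"
      using Riesz_representation[of "\<lambda>x. cinner (T x) y"] by blast
    then show ?thesis by blast
  qed
  then have "\<exists>S. \<forall>y x. cinner (T x) y = cinner x (S y)" by (intro choice) blast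
  then obtain S where S: "\<forall>x y. cinner (T x) y = cinner x (S y)" by blast
  have "\<forall>x y. cinner (T x) y = cinner x (cadjoint T y)"
    unfolding cadjoint_def
  proof (rule theI[where a = S])
    show "\<forall>x y. cinner (T x) y = cinner x (S y)" by (rule S)
  next
    fix S' assume S': "\<forall>x y. cinner (T x) y = cinner x (S' y)"
    have "cinner z (S' y) = cinner z (S y)" for y z using S S' by metis
    then show "S' = S" by (intro ext cinner_ext)
  qed
  then show ?thesis by blast
qed

section \<open>The adjoint with respect to a positive operator\<close>

text \<open>The sets on which all \<open>f \<in> F\<close> are bounded by \<open>n\<close> are closed and cover the space, so by the
  Baire category theorem one of them contains a ball; subtracting the value at the centre moves the
  bound to the origin.\<close>

lemma uniform_boundedness:
  fixes F :: "('a::{real_normed_vector, complete_space} \<Rightarrow> 'b::real_normed_vector) set"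
  assumes lin: "\<And>f. f \<in> F \<Longrightarrow> bounded_linear f"
    and ptw: "\<And>x. \<exists>M. \<forall>f\<in>F. norm (f x) \<le> M"
  obtains K where "K \<ge> 0" "\<And>f x. f \<in> F \<Longrightarrow> norm (f x) \<le> K * norm x"
proof -
  define E where "E n = (\<Inter>f\<in>F. {x. norm (f x) \<le> real n})" for n :: nat
  have cl: "closed (E n)" for n
    unfolding E_def
    by (intro closed_INT ballI closed_Collect_le continuous_on_norm continuous_on_const
        linear_continuous_on lin)
  have "x \<in> \<Union>(range E)" for x
  proof -
    obtain M where "\<forall>f\<in>F. norm (f x) \<le> M" using ptw by blast
    moreover obtain n where "M \<le> real n" using real_arch_simple by blast
    ultimately have "x \<in> E n" by (auto simp: E_def intro: order_trans)
    then show ?thesis by blast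
  qed
  then have UN: "\<Union>(range E) = UNIV" by blast
  have "\<exists>n. interior (E n) \<noteq> {}"
  proof (rule ccontr)
    assume "\<not> ?thesis"
    then have "Met_TC.mtopology interior_of \<Union>(range E) = {}"
      using cl by (intro Met_TC.metric_Baire_category_alt) (auto simp: complete_UNIV)
    then show False by (simp add: UN)
  qed
  then obtain n a r where r: "r > 0" "ball a r \<subseteq> E n"
    by (meson equals0I mem_interior)
  have "norm (f x) \<le> 4 * real n / r * norm x" if f: "f \<in> F" for f x
  proof (cases "x = 0")
    case True
    then show ?thesis using linear_simps(3)[OF lin[OF f]] by simp
  next
    case False
    interpret bounded_linear f by (rule lin[OF f])
    \<comment> \<open>Half of the largest admissible multiple, to stay inside the open ball.\<close>
    define t where "t = r / (2 * norm x)"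
    have t: "t > 0" using r False by (simp add: t_def)
    have "a \<in> ball a r" "a + t *\<^sub>R x \<in> ball a r"
      using r False by (auto simp: t_def dist_norm)
    then have "norm (f a) \<le> n" "norm (f (a + t *\<^sub>R x)) \<le> n"
      using r(2) f unfolding E_def by blast+
    then have "norm (f (a + t *\<^sub>R x) - f a) \<le> 2 * real n"
      using norm_triangle_ineq4[of "f (a + t *\<^sub>R x)" "f a"] by linarith
    then have "t * norm (f x) \<le> 2 * real n" using t by (simp add: add scaleR)
    then have "norm (f x) \<le> 2 * real n / t" using t by (simp add: field_simps)
    also have "\<dots> = 4 * real n / r * norm x" using r False by (simp add: t_def)
    finally show ?thesis .
  qed
  then show ?thesis using that[of "4 * real n / r"] r(1) by auto
qed

text \<open>The distinguished adjoint is singled out by its range, and taking it twice need not return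
  \<open>T\<close>. As a relation, adjointness is symmetric in \<open>T\<close> and \<open>X\<close>, so that the estimates
  apply to operators and adjoints alike.\<close>

definition A_adjoint_pair :: "('a::complex_inner \<Rightarrow> 'a) \<Rightarrow> ('a \<Rightarrow> 'a) \<Rightarrow> ('a \<Rightarrow> 'a) \<Rightarrow> bool"
  where "A_adjoint_pair A T X \<longleftrightarrow> bounded_clinear T \<and> bounded_clinear X
    \<and> (\<forall>x y. A_inner A (T x) y = A_inner A x (X y))"

lemma csubspace_closure_range:
  assumes A: "bounded_clinear A"
  shows "csubspace (closure (range A))"
  unfolding csubspace_def
proof (intro conjI ballI allI)
  show "0 \<in> closure (range A)"
    using closure_subset bounded_clinearD(4)[OF A] by (metis rangeI subsetD)
next
  fix x y assume "x \<in> closure (range A)" "y \<in> closure (range A)"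
  then obtain s t where "\<And>n. s n \<in> range A" "s \<longlonglongrightarrow> x" "\<And>n. t n \<in> range A" "t \<longlonglongrightarrow> y"
    unfolding closure_sequential by blast
  moreover have "u + v \<in> range A" if "u \<in> range A" "v \<in> range A" for u v
    using that bounded_clinearD(1)[OF A, symmetric] by auto
  ultimately have "\<forall>n. s n + t n \<in> range A" "(\<lambda>n. s n + t n) \<longlonglongrightarrow> x + y"
    by (auto intro: tendsto_add)
  then show "x + y \<in> closure (range A)"
    unfolding closure_sequential by (intro exI conjI)
next
  fix c x assume x: "x \<in> closure (range A)"
  have "bounded_linear (\<lambda>x. c *\<^sub>C (x::'b))"
    by (rule bounded_linear_intro[where K = "cmod c"])
      (auto simp: scaleC_add_right norm_scaleC scaleR_scaleC scaleC_scaleC mult.commute)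
  then have "(\<lambda>x. c *\<^sub>C x) ` closure (range A) \<subseteq> closure ((\<lambda>x. c *\<^sub>C x) ` range A)"
    by (rule closure_bounded_linear_image_subset)
  moreover have "(\<lambda>x. c *\<^sub>C x) ` range A \<subseteq> range A"
    using bounded_clinearD(3)[OF A, symmetric] by auto
  ultimately have "(\<lambda>x. c *\<^sub>C x) ` closure (range A) \<subseteq> closure (range A)"
    by (meson closure_mono order_trans)
  then show "c *\<^sub>C x \<in> closure (range A)" using x by blast
qed

text \<open>\<open>A\<close> is self-adjoint, so a kernel vector is orthogonal to the range, and the vectors
  orthogonal to it form a closed set.\<close>

lemma kernel_orthogonal_closure_range:
  fixes A :: "'a::complex_inner \<Rightarrow> 'a"
  assumes A: "positive_op A" and u: "A u = 0" and v: "v \<in> closure (range A)"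
  shows "cinner u v = 0"
proof -
  have "closed {v. cinner u v = 0}"
    by (intro closed_Collect_eq linear_continuous_on bounded_linear_cinner_right continuous_on_const)
  moreover have "range A \<subseteq> {v. cinner u v = 0}"
    using u positive_op_selfadjoint[OF A, of u] by auto
  ultimately show ?thesis using v closure_minimal by blast
qed

lemma positive_op_inj_on_closure_range:
  fixes A :: "'a::complex_inner \<Rightarrow> 'a"
  assumes A: "positive_op A"
  shows "inj_on A (closure (range A))"
proof (rule inj_onI)
  fix u v assume uv: "u \<in> closure (range A)" "v \<in> closure (range A)" and eq: "A u = A v"
  have "A (u - v) = 0" using eq by (simp add: bounded_clinearD[OF A_clinear[OF A]])
  then have "cinner (u - v) u = 0" "cinner (u - v) v = 0"
    using kernel_orthogonal_closure_range[OF A] uv by blast+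
  then have "cinner (u - v) (u - v) = 0" by (simp add: cinner_diff_right)
  then show "u = v" by (simp add: cinner_eq_zero_iff)
qed

text \<open>Every vector differs by a kernel vector from its projection onto the closure of the range.
  Together with injectivity there, this makes \<open>A\<close> a bijection from the closure of its range onto its
  range.\<close>

lemma positive_op_range_closure_range:
  fixes A :: "'a::chilbert_space \<Rightarrow> 'a"
  assumes A: "positive_op A"
  shows "range A = A ` closure (range A)"
proof -
  have "\<exists>p \<in> closure (range A). A z = A p" for z
  proof -
    obtain p where p: "p \<in> closure (range A)" "\<And>v. v \<in> closure (range A) \<Longrightarrow> cinner (z - p) v = 0"
      using orthogonal_projection_exists[OF csubspace_closure_range[OF A_clinear[OF A]]]
        closed_closure by blast
    have "A (A (z - p)) \<in> closure (range A)"
      by (rule subsetD[OF closure_subset rangeI])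
    then have "cinner (A (z - p)) (A (z - p)) = 0"
      unfolding positive_op_selfadjoint[OF A, of "z - p"] by (rule p(2))
    then have "A z = A p"
      by (simp add: cinner_eq_zero_iff bounded_clinearD[OF A_clinear[OF A]])
    then show ?thesis using p(1) by blast
  qed
  then show ?thesis by auto
qed

lemma cadjoint_linear:
  fixes T :: "'a::chilbert_space \<Rightarrow> 'b::complex_inner"
  assumes T: "bounded_clinear T"
  shows "cadjoint T (x + y) = cadjoint T x + cadjoint T y" "cadjoint T (c *\<^sub>C x) = c *\<^sub>C cadjoint T x"
  by (rule cinner_ext, simp add: cinner_cadjoint[OF T, symmetric] cinner_add_right cinner_scaleC_right)+

text \<open>This is Douglas's factorization of \<open>T\<^sup>*A\<close> through \<open>A\<close>. The solution \<open>X\<close> is unique, hence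
  linear. For its boundedness it suffices to bound \<open>\<langle>Xx | Az\<rangle> = \<langle>x | ATz\<rangle>\<close> by a multiple of
  \<open>\<parallel>x\<parallel> \<parallel>Az\<parallel>\<close>: the vectors \<open>Az\<close> are dense in a space that contains \<open>Xx\<close>.\<close>

lemma A_adjoint_pair_A_adjoint:
  fixes A T :: "'a::chilbert_space \<Rightarrow> 'a"
  assumes A: "positive_op A" and "T \<in> A_adjointable A"
  shows "A_adjoint_pair A T (A_adjoint A T)"
proof -
  have T: "bounded_clinear T" and ran: "\<And>x. cadjoint T (A x) \<in> range A"
    using assms(2) by (auto simp: A_adjointable_def)
  note Alin = bounded_clinearD[OF A_clinear[OF A]]
  define V where "V = closure (range A)"
  have V: "csubspace V" unfolding V_def by (rule csubspace_closure_range[OF A_clinear[OF A]])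
  have "\<forall>x. \<exists>p. p \<in> V \<and> A p = cadjoint T (A x)"
  proof
    fix x
    have "cadjoint T (A x) \<in> A ` V"
      using ran[of x] positive_op_range_closure_range[OF A] unfolding V_def by blast
    then show "\<exists>p. p \<in> V \<and> A p = cadjoint T (A x)" by auto
  qed
  then obtain X where X: "\<And>x. X x \<in> V" "\<And>x. A (X x) = cadjoint T (A x)" by metis
  have inj: "u = v" if "u \<in> V" "v \<in> V" "A u = A v" for u v
    using positive_op_inj_on_closure_range[OF A] that by (auto simp: V_def inj_on_def)
  have key: "cinner (X x) (A z) = cinner x (A (T z))" for x z
  proof -
    have "cinner (X x) (A z) = cinner (cadjoint T (A x)) z"
      by (simp add: positive_op_selfadjoint[OF A, symmetric] X(2))
    also have "\<dots> = cnj (cinner (T z) (A x))"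
      using cinner_cadjoint[OF T] cinner_commute by metis
    also have "\<dots> = cinner (A x) (T z)" by (rule cinner_commute[symmetric])
    finally show ?thesis by (simp add: positive_op_selfadjoint[OF A])
  qed
  \<comment> \<open>Each of these functionals is bounded at \<open>x\<close> by \<open>\<parallel>Xx\<parallel>\<close>, uniformly in \<open>z\<close>.\<close>
  define F where "F = {\<lambda>x. cinner x (A (T z)) | z. norm (A z) \<le> 1}"
  obtain K where K: "K \<ge> 0" "\<And>f x. f \<in> F \<Longrightarrow> norm (f x) \<le> K * norm x"
  proof (rule uniform_boundedness[of F])
    show "bounded_linear f" if "f \<in> F" for f
      using that by (auto simp: F_def intro: bounded_linear_cinner_left)
    fix x
    have "cmod (cinner x (A (T z))) \<le> norm (X x)" if "norm (A z) \<le> 1" for z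
    proof -
      have "cmod (cinner x (A (T z))) \<le> norm (X x) * norm (A z)"
        using Cauchy_Schwarz[of "X x" "A z"] by (simp add: key)
      also have "\<dots> \<le> norm (X x)" using that by (simp add: mult_left_le)
      finally show ?thesis .
    qed
    then show "\<exists>M. \<forall>f\<in>F. norm (f x) \<le> M" by (auto simp: F_def)
  qed blast
  have XK: "norm (X x) \<le> K * norm x" for x
  proof -
    have "cmod (cinner (X x) (A z)) \<le> K * norm x * norm (A z)" for z
    proof (cases "A z = 0")
      case False
      define c where "c = complex_of_real (1 / norm (A z))"
      have "norm (A (c *\<^sub>C z)) \<le> 1"
        using False by (simp add: Alin norm_scaleC c_def norm_divide)
      then have "(\<lambda>x. cinner x (A (T (c *\<^sub>C z)))) \<in> F" by (auto simp: F_def)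
      from K(2)[OF this, of x] have "cmod (cinner (X x) (A (c *\<^sub>C z))) \<le> K * norm x"
        by (simp add: key)
      then show ?thesis
        using False by (simp add: Alin cinner_scaleC_right norm_mult c_def norm_divide field_simps)
    qed simp
    moreover have "closed {v. cmod (cinner (X x) v) \<le> K * norm x * norm v}"
      by (intro closed_Collect_le continuous_on_norm continuous_intros
          linear_continuous_on bounded_linear_cinner_right)
    ultimately have "V \<subseteq> {v. cmod (cinner (X x) v) \<le> K * norm x * norm v}"
      unfolding V_def by (intro closure_minimal) auto
    \<comment> \<open>Testing against \<open>Xx\<close> itself is possible since it lies in \<open>V\<close>.\<close>
    then have "cmod (cinner (X x) (X x)) \<le> K * norm x * norm (X x)" using X(1) by blast
    then have "norm (X x) * norm (X x) \<le> K * norm x * norm (X x)"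
      by (simp add: cinner_self norm_power power2_eq_square norm_mult)
    then show ?thesis using K(1) by (cases "norm (X x) = 0") auto
  qed
  have Xlin: "bounded_clinear X"
  proof (rule bounded_clinearI[OF _ _ XK])
    show "X (x + y) = X x + X y" for x y
      by (rule inj) (use V X(1) in \<open>auto simp: csubspace_def X(2) Alin cadjoint_linear[OF T]\<close>)
    show "X (c *\<^sub>C x) = c *\<^sub>C X x" for c x
      by (rule inj) (use V X(1) in \<open>auto simp: csubspace_def X(2) Alin cadjoint_linear[OF T]\<close>)
  qed
  have "A_adjoint A T = X"
    unfolding A_adjoint_def
  proof (rule the_equality)
    show "bounded_clinear X \<and> A \<circ> X = cadjoint T \<circ> A \<and> range X \<subseteq> closure (range A)"
      using Xlin X by (auto simp: V_def fun_eq_iff)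
  next
    fix Y assume Y: "bounded_clinear Y \<and> A \<circ> Y = cadjoint T \<circ> A \<and> range Y \<subseteq> closure (range A)"
    then have "Y x \<in> V" "A (Y x) = A (X x)" for x
      using X(2) by (auto simp: V_def fun_eq_iff)
    then show "Y = X" using inj X(1) by (intro ext) blast
  qed
  moreover have "A_inner A (T x) y = A_inner A x (X y)" for x y
    using cinner_cadjoint[OF T, of x "A y"]
    by (simp add: A_inner_def positive_op_selfadjoint[OF A] X(2))
  ultimately show ?thesis using T Xlin by (simp add: A_adjoint_pair_def)
qed

section \<open>Boundedness in the seminorm\<close>

text \<open>Krein's argument. If \<open>\<parallel>Wx\<parallel>\<^sub>A = b\<parallel>x\<parallel>\<^sub>A\<close>, repeated squaring with the Cauchy-Schwarz
  inequality makes the seminorm of \<open>W\<^sup>mx\<close> at least \<open>b\<^sup>m\<parallel>x\<parallel>\<^sub>A\<close> for every power \<open>m\<close> of two. It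
  is also at most a constant times \<open>K\<^sup>m\<close>, where \<open>K\<close> bounds the ordinary norm of \<open>W\<close>, so that
  \<open>b \<le> K\<close>.\<close>

lemma symmetrizable_A_bounded:
  fixes A W :: "'a::complex_inner \<Rightarrow> 'a"
  assumes A: "positive_op A" and W: "bounded_clinear W"
    and sym: "\<And>x y. A_inner A (W x) y = A_inner A x (W y)"
  obtains K where "K \<ge> 0" "\<And>x. A_seminorm A (W x) \<le> K * A_seminorm A x"
proof -
  obtain K where K: "0 < K" "\<And>x. norm (W x) \<le> norm x * K"
    using W bounded_linear.pos_bounded unfolding bounded_clinear_def by blast
  obtain C where C: "C \<ge> 0" "\<And>x. A_seminorm A x \<le> C * norm x"
    using A_seminorm_le_norm[OF A] by blast
  have symm: "A_inner A ((W ^^ m) x) y = A_inner A x ((W ^^ m) y)" for m x y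
    by (induction m arbitrary: x y) (simp_all add: sym funpow_swap1)
  have pow: "norm ((W ^^ m) x) \<le> K ^ m * norm x" for m x
  proof (induction m)
    case (Suc m)
    have "norm ((W ^^ Suc m) x) \<le> norm ((W ^^ m) x) * K" using K(2) by simp
    also have "\<dots> \<le> K ^ m * norm x * K" using Suc K(1) by simp
    finally show ?case by (simp add: mult_ac)
  qed simp
  have "A_seminorm A (W x) \<le> K * A_seminorm A x" for x
  proof (rule ccontr)
    assume "\<not> ?thesis"
    then have gt: "K * A_seminorm A x < A_seminorm A (W x)" by simp
    define p where "p = A_seminorm A x"
    define a where "a n = A_seminorm A ((W ^^ (2 ^ n)) x)" for n
    have p0: "p \<ge> 0" and a0: "a n \<ge> 0" for n
      by (simp_all add: p_def a_def A_seminorm_nonneg[OF A])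
    have step: "(a n)\<^sup>2 \<le> a (Suc n) * p" for n
    proof -
      let ?m = "2 ^ n :: nat"
      have "complex_of_real ((a n)\<^sup>2) = A_inner A ((W ^^ ?m) ((W ^^ ?m) x)) x"
        unfolding a_def A_inner_self[OF A, symmetric] by (rule symm[symmetric])
      also have "(W ^^ ?m) ((W ^^ ?m) x) = (W ^^ (2 ^ Suc n)) x"
        by (simp add: mult_2 funpow_add)
      finally have "(a n)\<^sup>2 = cmod (A_inner A ((W ^^ (2 ^ Suc n)) x) x)"
        by (metis abs_of_nonneg norm_of_real zero_le_power2)
      then show ?thesis
        using A_Cauchy_Schwarz[OF A] unfolding a_def p_def by simp
    qed
    \<comment> \<open>If \<open>x\<close> has seminorm zero, a single Cauchy-Schwarz step already forces \<open>W x\<close> to have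
      seminorm zero.\<close>
    have p: "p > 0"
    proof (rule ccontr)
      assume "\<not> p > 0"
      then have "p = 0" using p0 by simp
      then have "a 0 = 0" using step[of 0] by simp
      then show False using gt \<open>p = 0\<close> by (simp add: a_def p_def)
    qed
    define b where "b = a 0 / p"
    have bK: "b > K" using gt p by (simp add: b_def a_def p_def field_simps)
    have grow: "p * b ^ (2 ^ n) \<le> a n" for n
    proof (induction n)
      case 0
      then show ?case using p by (simp add: b_def)
    next
      case (Suc n)
      have "(p * b ^ (2 ^ n))\<^sup>2 \<le> (a n)\<^sup>2"
        using Suc p bK K(1) by (intro power_mono) auto
      also have "\<dots> \<le> a (Suc n) * p" by (rule step)
      finally have "p * (p * b ^ (2 ^ Suc n)) \<le> p * a (Suc n)"
        by (simp add: power_mult_distrib power_even_eq power2_eq_square mult_ac)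
      then show ?case using p by simp
    qed
    define L where "L = C * norm x / p"
    have le: "(b / K) ^ (2 ^ n) \<le> L" for n
    proof -
      have "a n \<le> C * (K ^ (2 ^ n) * norm x)"
        using C pow order_trans mult_left_mono unfolding a_def by metis
      with grow[of n] have "p * b ^ (2 ^ n) \<le> C * (K ^ (2 ^ n) * norm x)" by linarith
      then show ?thesis using p K(1) by (simp add: L_def power_divide field_simps)
    qed
    have "b / K > 1" using bK K(1) by simp
    then obtain n where "L < (b / K) ^ n" using real_arch_pow by blast
    also have "\<dots> \<le> (b / K) ^ (2 ^ n)"
      using \<open>b / K > 1\<close> by (intro power_increasing) (auto intro: less_imp_le)
    also have "\<dots> \<le> L" by (rule le)
    finally show False by simp
  qed
  then show ?thesis using that[of K] K(1) by auto
qed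

text \<open>A nonnegative constant, rather than a positive one, defines the same property and is easier
  to provide.\<close>

definition A_bounded :: "('a::complex_inner \<Rightarrow> 'a) \<Rightarrow> ('a \<Rightarrow> 'a) \<Rightarrow> bool"
  where "A_bounded A T \<longleftrightarrow> (\<exists>K\<ge>0. \<forall>x. A_seminorm A (T x) \<le> K * A_seminorm A x)"

context
  fixes A :: "'a::complex_inner \<Rightarrow> 'a"
  assumes A: "positive_op A"
begin

lemma A_adjoint_pair_sym:
  assumes "A_adjoint_pair A T X"
  shows "A_adjoint_pair A X T"
  using assms A_inner_commute[OF A] unfolding A_adjoint_pair_def by metis

lemma A_adjoint_pair_add:
  assumes "A_adjoint_pair A T X" "A_adjoint_pair A S Y"
  shows "A_adjoint_pair A (\<lambda>x. T x + S x) (\<lambda>x. X x + Y x)"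
  using assms by (simp add: A_adjoint_pair_def bounded_clinear_add A_inner_simps[OF A])

lemma A_adjoint_pair_diff:
  assumes "A_adjoint_pair A T X" "A_adjoint_pair A S Y"
  shows "A_adjoint_pair A (\<lambda>x. T x - S x) (\<lambda>x. X x - Y x)"
  using assms by (simp add: A_adjoint_pair_def bounded_clinear_diff A_inner_simps[OF A])

text \<open>Apply Krein's bound to \<open>XT\<close>, which is symmetric for the semi-inner product, and use
  \<open>\<parallel>Tx\<parallel>\<^sub>A\<^sup>2 = \<langle>x, XTx\<rangle>\<^sub>A\<close>.\<close>

lemma A_adjoint_pair_A_bounded:
  assumes pair: "A_adjoint_pair A T X"
  shows "A_bounded A T"
proof -
  have lin: "bounded_clinear T" "bounded_clinear X" and adj: "\<And>x y. A_inner A (T x) y = A_inner A x (X y)"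
    using pair by (auto simp: A_adjoint_pair_def)
  have adj': "A_inner A (X x) y = A_inner A x (T y)" for x y
    using A_adjoint_pair_sym[OF pair] by (simp add: A_adjoint_pair_def)
  obtain K where K: "K \<ge> 0" "\<And>x. A_seminorm A (X (T x)) \<le> K * A_seminorm A x"
    using symmetrizable_A_bounded[OF A bounded_clinear_compose[OF lin(2,1)]] adj adj' by metis
  have "A_seminorm A (T x) \<le> sqrt K * A_seminorm A x" for x
  proof -
    have "complex_of_real ((A_seminorm A (T x))\<^sup>2) = A_inner A x (X (T x))"
      by (simp only: A_inner_self[OF A, symmetric] adj)
    then have "(A_seminorm A (T x))\<^sup>2 = cmod (A_inner A x (X (T x)))"
      by (metis abs_of_nonneg norm_of_real zero_le_power2)
    also have "\<dots> \<le> A_seminorm A x * A_seminorm A (X (T x))" by (rule A_Cauchy_Schwarz[OF A])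
    also have "\<dots> \<le> A_seminorm A x * (K * A_seminorm A x)"
      using K(2) A_seminorm_nonneg[OF A] by (intro mult_left_mono)
    also have "\<dots> = (sqrt K * A_seminorm A x)\<^sup>2"
      using K(1) by (simp add: power_mult_distrib power2_eq_square[of "A_seminorm A x"])
    finally show ?thesis
      by (rule power2_le_imp_le) (simp add: K(1) A_seminorm_nonneg[OF A])
  qed
  then show ?thesis unfolding A_bounded_def using K(1) by (intro exI[of _ "sqrt K"]) auto
qed

text \<open>Cancel one factor in
  \<open>\<parallel>Xx\<parallel>\<^sub>A\<^sup>2 = \<langle>TXx, x\<rangle>\<^sub>A \<le> a \<parallel>Xx\<parallel>\<^sub>A \<parallel>x\<parallel>\<^sub>A\<close>.\<close>

lemma A_adjoint_pair_seminorm_le: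
  assumes pair: "A_adjoint_pair A T X" and a: "\<And>x. A_seminorm A (T x) \<le> a * A_seminorm A x"
  shows "A_seminorm A (X x) \<le> a * A_seminorm A x"
proof -
  note nn = A_seminorm_nonneg[OF A]
  have "complex_of_real ((A_seminorm A (X x))\<^sup>2) = A_inner A (T (X x)) x"
    using pair by (simp only: A_inner_self[OF A, symmetric] A_adjoint_pair_def)
  then have "(A_seminorm A (X x))\<^sup>2 = cmod (A_inner A (T (X x)) x)"
    by (metis abs_of_nonneg norm_of_real zero_le_power2)
  also have "\<dots> \<le> A_seminorm A (T (X x)) * A_seminorm A x" by (rule A_Cauchy_Schwarz[OF A])
  also have "\<dots> \<le> a * A_seminorm A (X x) * A_seminorm A x"
    using a nn by (intro mult_right_mono)
  finally have le: "A_seminorm A (X x) * A_seminorm A (X x) \<le> (a * A_seminorm A x) * A_seminorm A (X x)"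
    by (simp add: power2_eq_square mult_ac)
  show ?thesis
  proof (cases "A_seminorm A (X x) = 0")
    case True
    then show ?thesis using a[of x] nn[of "T x"] by linarith
  next
    case False
    then have "A_seminorm A (X x) > 0" using nn[of "X x"] by linarith
    then show ?thesis using le by simp
  qed
qed

text \<open>Scaling reduces this to seminorm 1. If the seminorm of \<open>x\<close> vanishes, scaling is impossible
  and boundedness makes the seminorm of \<open>Tx\<close> vanish too.\<close>

lemma A_seminorm_le_opnorm:
  assumes T: "bounded_clinear T" and bd: "A_bounded A T"
  shows "A_seminorm A (T x) \<le> A_opnorm A T * A_seminorm A x"
proof -
  obtain K where K: "K \<ge> 0" "\<And>x. A_seminorm A (T x) \<le> K * A_seminorm A x"
    using bd by (auto simp: A_bounded_def)
  show ?thesis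
  proof (cases "A_seminorm A x = 0")
    case True
    then show ?thesis using K(2)[of x] by simp
  next
    case False
    then have p: "A_seminorm A x > 0" using A_seminorm_nonneg[OF A, of x] by linarith
    define c where "c = complex_of_real (1 / A_seminorm A x)"
    have c: "cmod c = 1 / A_seminorm A x" using p by (simp add: c_def norm_divide)
    have one: "A_seminorm A (c *\<^sub>C x) = 1" using p by (simp add: A_seminorm_scaleC[OF A] c)
    have "bdd_above (insert 0 {A_seminorm A (T x) | x. A_seminorm A x = 1})"
      using K by (intro bdd_aboveI[of _ K]) (auto, metis mult.right_neutral)
    then have "A_seminorm A (T (c *\<^sub>C x)) \<le> A_opnorm A T"
      unfolding A_opnorm_def using one by (intro cSup_upper) auto
    then show ?thesis
      using p by (simp add: bounded_clinearD[OF T] A_seminorm_scaleC[OF A] c field_simps)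
  qed
qed

text \<open>The quadratic form of a product such as \<open>PQ\<^sup>#\<close> is rewritten as \<open>\<langle>Ux, Vx\<rangle>\<^sub>A\<close> with
  separately bounded factors, which makes the supremum finite.\<close>

lemma A_numradius_bound:
  assumes T: "bounded_clinear T" and bd: "A_bounded A U" "A_bounded A V"
    and eq: "\<And>x. A_inner A (T x) x = A_inner A (U x) (V x)"
  shows "0 \<le> A_numradius A T"
    and "cmod (A_inner A (U x) (V x)) \<le> A_numradius A T * (A_seminorm A x)\<^sup>2"
proof -
  note nn = A_seminorm_nonneg[OF A]
  obtain K where K: "K \<ge> 0" "\<And>x. A_seminorm A (U x) \<le> K * A_seminorm A x"
    using bd(1) by (auto simp: A_bounded_def)
  obtain L where L: "L \<ge> 0" "\<And>x. A_seminorm A (V x) \<le> L * A_seminorm A x"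
    using bd(2) by (auto simp: A_bounded_def)
  have KL: "cmod (A_inner A (T x) x) \<le> K * L * (A_seminorm A x)\<^sup>2" for x
  proof -
    have "cmod (A_inner A (T x) x) \<le> A_seminorm A (U x) * A_seminorm A (V x)"
      unfolding eq by (rule A_Cauchy_Schwarz[OF A])
    also have "\<dots> \<le> (K * A_seminorm A x) * (L * A_seminorm A x)"
      using K L nn by (intro mult_mono) auto
    finally show ?thesis by (simp add: power2_eq_square mult_ac)
  qed
  have bdd: "bdd_above (insert 0 {cmod (A_inner A (T x) x) | x. A_seminorm A x = 1})"
    using KL K L by (intro bdd_aboveI[of _ "K * L"]) (auto, metis mult.right_neutral power_one)
  show "0 \<le> A_numradius A T"
    unfolding A_numradius_def by (rule cSup_upper[OF _ bdd]) simp
  show "cmod (A_inner A (U x) (V x)) \<le> A_numradius A T * (A_seminorm A x)\<^sup>2"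
  proof (cases "A_seminorm A x = 0")
    case True
    then show ?thesis using KL[of x] by (simp add: eq)
  next
    case False
    then have p: "A_seminorm A x > 0" using nn[of x] by linarith
    define c where "c = complex_of_real (1 / A_seminorm A x)"
    have c: "cmod c = 1 / A_seminorm A x" using p by (simp add: c_def norm_divide)
    have one: "A_seminorm A (c *\<^sub>C x) = 1" using p by (simp add: A_seminorm_scaleC[OF A] c)
    then have "cmod (A_inner A (T (c *\<^sub>C x)) (c *\<^sub>C x)) \<le> A_numradius A T"
      unfolding A_numradius_def by (intro cSup_upper bdd) auto
    then show ?thesis
      using p by (simp add: bounded_clinearD[OF T] A_inner_simps[OF A] norm_mult c eq
          power2_eq_square field_simps)
  qed
qed

section \<open>Estimates for rows and columns\<close>

lemma A_seminorm_add_sq: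
  "(A_seminorm A (x + y))\<^sup>2 = (A_seminorm A x)\<^sup>2 + (A_seminorm A y)\<^sup>2 + 2 * Re (A_inner A x y)"
  and A_seminorm_diff_sq:
  "(A_seminorm A (x - y))\<^sup>2 = (A_seminorm A x)\<^sup>2 + (A_seminorm A y)\<^sup>2 - 2 * Re (A_inner A x y)"
proof -
  have sq: "(A_seminorm A z)\<^sup>2 = Re (A_inner A z z)" for z
    by (simp add: A_inner_self[OF A])
  have "Re (A_inner A y x) = Re (A_inner A x y)"
    using A_inner_commute[OF A, of x y] by simp
  then show "(A_seminorm A (x + y))\<^sup>2 = (A_seminorm A x)\<^sup>2 + (A_seminorm A y)\<^sup>2 + 2 * Re (A_inner A x y)"
    "(A_seminorm A (x - y))\<^sup>2 = (A_seminorm A x)\<^sup>2 + (A_seminorm A y)\<^sup>2 - 2 * Re (A_inner A x y)"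
    by (simp_all add: sq A_inner_simps[OF A])
qed

text \<open>Add \<open>\<minusplus>2 Re \<langle>u, v\<rangle>\<^sub>A\<close> to \<open>\<parallel>u \<plusminus> v\<parallel>\<^sub>A\<^sup>2\<close>; both signs give a bound, hence the
  minimum. In the applications \<open>s\<close> is the seminorm of the vector from which \<open>u\<close> and \<open>v\<close> are
  computed.\<close>

lemma sum_sq_le_min:
  assumes "A_seminorm A (u + v) \<le> a * s" "A_seminorm A (u - v) \<le> b * s"
    and "cmod (A_inner A u v) \<le> w * s\<^sup>2"
  shows "(A_seminorm A u)\<^sup>2 + (A_seminorm A v)\<^sup>2 \<le> (min (a\<^sup>2) (b\<^sup>2) + 2 * w) * s\<^sup>2"
proof -
  have "(A_seminorm A (u + v))\<^sup>2 \<le> (a * s)\<^sup>2" "(A_seminorm A (u - v))\<^sup>2 \<le> (b * s)\<^sup>2"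
    using assms A_seminorm_nonneg[OF A] by (auto intro: power_mono)
  moreover have "\<bar>Re (A_inner A u v)\<bar> \<le> w * s\<^sup>2"
    using abs_Re_le_cmod assms(3) by (rule order_trans)
  ultimately have "(A_seminorm A u)\<^sup>2 + (A_seminorm A v)\<^sup>2 \<le> a\<^sup>2 * s\<^sup>2 + 2 * (w * s\<^sup>2)"
    "(A_seminorm A u)\<^sup>2 + (A_seminorm A v)\<^sup>2 \<le> b\<^sup>2 * s\<^sup>2 + 2 * (w * s\<^sup>2)"
    by (simp_all add: A_seminorm_add_sq A_seminorm_diff_sq power_mult_distrib)
  then show ?thesis by (auto simp: min_def distrib_right)
qed

lemma column_sum_sq_le:
  assumes U: "A_adjoint_pair A U U'" and V: "A_adjoint_pair A V V'"
    and w: "cmod (A_inner A (U x) (V x)) \<le> w * (A_seminorm A x)\<^sup>2"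
  shows "(A_seminorm A (U x))\<^sup>2 + (A_seminorm A (V x))\<^sup>2
    \<le> (min ((A_opnorm A (\<lambda>x. U x + V x))\<^sup>2) ((A_opnorm A (\<lambda>x. U x - V x))\<^sup>2) + 2 * w) * (A_seminorm A x)\<^sup>2"
proof -
  have le: "A_seminorm A (T x) \<le> A_opnorm A T * A_seminorm A x" if "A_adjoint_pair A T X" for T X
    using that A_seminorm_le_opnorm[OF _ A_adjoint_pair_A_bounded[OF that]]
    by (simp add: A_adjoint_pair_def)
  show ?thesis
    using le[OF A_adjoint_pair_add[OF U V]] le[OF A_adjoint_pair_diff[OF U V]]
    by (intro sum_sq_le_min w)
qed

text \<open>The vectors are images under the adjoints, but the bound involves the operators themselves,
  because the adjoint of \<open>U \<plusminus> V\<close> inherits the bound of \<open>U \<plusminus> V\<close>.\<close>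

lemma row_sum_sq_le:
  assumes U: "A_adjoint_pair A U U'" and V: "A_adjoint_pair A V V'"
    and w: "cmod (A_inner A (U' x) (V' x)) \<le> w * (A_seminorm A x)\<^sup>2"
  shows "(A_seminorm A (U' x))\<^sup>2 + (A_seminorm A (V' x))\<^sup>2
    \<le> (min ((A_opnorm A (\<lambda>x. U x + V x))\<^sup>2) ((A_opnorm A (\<lambda>x. U x - V x))\<^sup>2) + 2 * w) * (A_seminorm A x)\<^sup>2"
proof -
  have le: "A_seminorm A (X x) \<le> A_opnorm A T * A_seminorm A x" if "A_adjoint_pair A T X" for T X
    using that A_seminorm_le_opnorm[OF _ A_adjoint_pair_A_bounded[OF that]]
    by (intro A_adjoint_pair_seminorm_le[OF that]) (simp add: A_adjoint_pair_def)
  show ?thesis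
    using le[OF A_adjoint_pair_add[OF U V]] le[OF A_adjoint_pair_diff[OF U V]]
    by (intro sum_sq_le_min w)
qed

section \<open>The direct sum\<close>

lemma op_matrix_diag_inner:
  "A_inner (op_matrix A (\<lambda>_. 0) (\<lambda>_. 0) A) (x, y) (u, v) = A_inner A x u + A_inner A y v"
  by (simp add: A_inner_def op_matrix_def cinner_prod_def)

lemma op_matrix_diag_positive: "positive_op (op_matrix A (\<lambda>_. 0) (\<lambda>_. 0) A)"
proof -
  have lin: "bounded_linear A" using A by (simp add: positive_op_def bounded_clinear_def)
  have eq: "op_matrix A (\<lambda>_. 0) (\<lambda>_. 0) A = (\<lambda>z. (A (fst z), A (snd z)))"
    by (auto simp: op_matrix_def)
  show ?thesis
    unfolding positive_op_def bounded_clinear_def eq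
    using A lin
    by (auto simp: positive_op_def cinner_prod_def scaleC_prod_def bounded_clinearD[OF A_clinear[OF A]]
        intro!: bounded_linear_Pair bounded_linear_compose[OF lin] bounded_linear_fst bounded_linear_snd)
qed

lemma op_matrix_diag_seminorm_sq:
  "(A_seminorm (op_matrix A (\<lambda>_. 0) (\<lambda>_. 0) A) (x, y))\<^sup>2 = (A_seminorm A x)\<^sup>2 + (A_seminorm A y)\<^sup>2"
proof -
  have "complex_of_real ((A_seminorm (op_matrix A (\<lambda>_. 0) (\<lambda>_. 0) A) (x, y))\<^sup>2)
      = complex_of_real ((A_seminorm A x)\<^sup>2 + (A_seminorm A y)\<^sup>2)"
    unfolding of_real_add A_inner_self[OF A, symmetric]
      A_inner_self[OF op_matrix_diag_positive, symmetric] by (rule op_matrix_diag_inner)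
  then show ?thesis using of_real_eq_iff by blast
qed

text \<open>Here \<open>c\<close> is the squared bound of a column operator that sends \<open>z\<close> to \<open>(a, b)\<close>; the
  rest is the Cauchy-Schwarz inequality in the direct sum.\<close>

lemma direct_sum_inner_le:
  assumes c: "0 \<le> c" "(A_seminorm A a)\<^sup>2 + (A_seminorm A b)\<^sup>2 \<le> c * (A_seminorm A z)\<^sup>2"
    and z: "A_seminorm A z \<le> 1" and uv: "(A_seminorm A u)\<^sup>2 + (A_seminorm A v)\<^sup>2 = 1"
  shows "cmod (A_inner A a u + A_inner A b v) \<le> sqrt c"
proof -
  let ?D = "op_matrix A (\<lambda>_. 0) (\<lambda>_. 0) A"
  note D = op_matrix_diag_positive
  have "(A_seminorm ?D (u, v))\<^sup>2 = 1" by (simp add: op_matrix_diag_seminorm_sq uv)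
  then have one: "A_seminorm ?D (u, v) = 1"
    using A_seminorm_nonneg[OF D] by (metis power2_eq_1_iff neg_0_le_iff_le not_one_le_zero)
  have "(A_seminorm A z)\<^sup>2 \<le> 1" using z A_seminorm_nonneg[OF A] by (simp add: power_le_one)
  then have "(A_seminorm ?D (a, b))\<^sup>2 \<le> c"
    unfolding op_matrix_diag_seminorm_sq using c mult_left_le order_trans by metis
  then have "A_seminorm ?D (a, b) \<le> sqrt c"
    using real_le_rsqrt by blast
  then show ?thesis
    using A_Cauchy_Schwarz[OF D, of "(a, b)" "(u, v)"] by (simp add: op_matrix_diag_inner one)
qed

text \<open>The column with entries \<open>U\<close> and \<open>V\<close> sends \<open>z\<close> to \<open>(Uz, Vz)\<close>, which is paired here with
  \<open>(x, y)\<close>.\<close>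

lemma column_inner_le:
  assumes U: "A_adjoint_pair A U U'" and V: "A_adjoint_pair A V V'"
    and w: "0 \<le> w" "\<And>x. cmod (A_inner A (U x) (V x)) \<le> w * (A_seminorm A x)\<^sup>2"
    and z: "A_seminorm A z \<le> 1" and xy: "(A_seminorm A x)\<^sup>2 + (A_seminorm A y)\<^sup>2 = 1"
  shows "cmod (A_inner A (U z) x + A_inner A (V z) y)
    \<le> sqrt (min ((A_opnorm A (\<lambda>x. U x + V x))\<^sup>2) ((A_opnorm A (\<lambda>x. U x - V x))\<^sup>2) + 2 * w)"
  using w(1) by (intro direct_sum_inner_le[OF _ column_sum_sq_le[OF U V w(2)] z xy]) simp

text \<open>Moving the operators to the other side turns the row with entries \<open>U\<close> and \<open>V\<close> into the
  column of their adjoints.\<close>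

lemma row_inner_le:
  assumes U: "A_adjoint_pair A U U'" and V: "A_adjoint_pair A V V'"
    and w: "0 \<le> w" "\<And>x. cmod (A_inner A (U' x) (V' x)) \<le> w * (A_seminorm A x)\<^sup>2"
    and z: "A_seminorm A z \<le> 1" and xy: "(A_seminorm A x)\<^sup>2 + (A_seminorm A y)\<^sup>2 = 1"
  shows "cmod (A_inner A (U x) z + A_inner A (V y) z)
    \<le> sqrt (min ((A_opnorm A (\<lambda>x. U x + V x))\<^sup>2) ((A_opnorm A (\<lambda>x. U x - V x))\<^sup>2) + 2 * w)"
proof -
  have adj: "A_inner A (T u) z = cnj (A_inner A (X z) u)" if "A_adjoint_pair A T X" for T X u
    using A_adjoint_pair_sym[OF that] A_inner_commute[OF A, of "T u" z]
    by (simp add: A_adjoint_pair_def)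
  have "cmod (A_inner A (U x) z + A_inner A (V y) z)
      = cmod (cnj (A_inner A (U' z) x + A_inner A (V' z) y))"
    by (simp only: adj[OF U] adj[OF V] complex_cnj_add)
  also have "\<dots> = cmod (A_inner A (U' z) x + A_inner A (V' z) y)" by (rule complex_mod_cnj)
  also have "\<dots> \<le> sqrt (min ((A_opnorm A (\<lambda>x. U x + V x))\<^sup>2) ((A_opnorm A (\<lambda>x. U x - V x))\<^sup>2) + 2 * w)"
    using w(1) by (intro direct_sum_inner_le[OF _ row_sum_sq_le[OF U V w(2)] z xy]) simp
  finally show ?thesis .
qed

end

lemma A_numradius_le:
  assumes "0 \<le> c" "\<And>x. A_seminorm A x = 1 \<Longrightarrow> cmod (A_inner A (T x) x) \<le> c"
  shows "A_numradius A T \<le> c"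
  unfolding A_numradius_def using assms by (intro cSup_least) auto

section \<open>The bound for two-by-two operator matrices\<close>

theorem theorem2p6:
  fixes A P Q R S :: "'a::chilbert_space \<Rightarrow> 'a"
  assumes "positive_op A"
    and "P \<in> A_adjointable A" "Q \<in> A_adjointable A"
    and "R \<in> A_adjointable A" "S \<in> A_adjointable A"
  defines "\<mu> \<equiv>
      sqrt (min ((A_opnorm A (\<lambda>x. P x + Q x))\<^sup>2) ((A_opnorm A (\<lambda>x. P x - Q x))\<^sup>2)
        + 2 * A_numradius A (P \<circ> A_adjoint A Q))
    + sqrt (min ((A_opnorm A (\<lambda>x. R x + S x))\<^sup>2) ((A_opnorm A (\<lambda>x. R x - S x))\<^sup>2)
        + 2 * A_numradius A (S \<circ> A_adjoint A R))"
    and "\<nu> \<equiv>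
      sqrt (min ((A_opnorm A (\<lambda>x. P x + R x))\<^sup>2) ((A_opnorm A (\<lambda>x. P x - R x))\<^sup>2)
        + 2 * A_numradius A (A_adjoint A P \<circ> R))
    + sqrt (min ((A_opnorm A (\<lambda>x. Q x + S x))\<^sup>2) ((A_opnorm A (\<lambda>x. Q x - S x))\<^sup>2)
        + 2 * A_numradius A (A_adjoint A S \<circ> Q))"
  shows "A_numradius (op_matrix A (\<lambda>_. 0) (\<lambda>_. 0) A) (op_matrix P Q R S) \<le> min \<mu> \<nu>"
proof -
  let ?D = "op_matrix A (\<lambda>_. 0) (\<lambda>_. 0) A"
  note A = assms(1)
  note pair = A_adjoint_pair_A_adjoint[OF A]
  note p = pair[OF assms(2)] and q = pair[OF assms(3)] and r = pair[OF assms(4)] and s = pair[OF assms(5)]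
  note bd = A_adjoint_pair_A_bounded[OF A] and sym = A_adjoint_pair_sym[OF A]
  \<comment> \<open>The factors that make up \<open>P Q\<^sup>#\<close>, \<open>S R\<^sup>#\<close>, \<open>P\<^sup># R\<close> and \<open>S\<^sup># Q\<close> occur in the row
    and column estimates in the order of the matrix entries, which agrees with the order in the
    quadratic form for two of the products and reverses it for the other two.\<close>
  have w: "0 \<le> A_numradius A (T \<circ> Y)"
    "cmod (A_inner A (Y x) (X x)) \<le> A_numradius A (T \<circ> Y) * (A_seminorm A x)\<^sup>2"
    "cmod (A_inner A (X x) (Y x)) \<le> A_numradius A (T \<circ> Y) * (A_seminorm A x)\<^sup>2"
    if T: "A_adjoint_pair A T X" and Y: "A_adjoint_pair A Y S" for T X Y S x
  proof -
    have lin: "bounded_clinear (T \<circ> Y)"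
      using T Y bounded_clinear_compose[of T Y] by (simp add: A_adjoint_pair_def o_def)
    have eq: "A_inner A ((T \<circ> Y) x) x = A_inner A (Y x) (X x)" for x
      using T by (simp add: A_adjoint_pair_def)
    note * = A_numradius_bound[OF A lin bd[OF Y] bd[OF sym[OF T]] eq]
    show "0 \<le> A_numradius A (T \<circ> Y)"
      "cmod (A_inner A (Y x) (X x)) \<le> A_numradius A (T \<circ> Y) * (A_seminorm A x)\<^sup>2"
      by (rule *)+
    show "cmod (A_inner A (X x) (Y x)) \<le> A_numradius A (T \<circ> Y) * (A_seminorm A x)\<^sup>2"
      unfolding A_inner_commute[OF A, of "X x" "Y x"] complex_mod_cnj by (rule *)
  qed
  note row1 = row_inner_le[OF A p q w(1)[OF p sym[OF q]] w(3)[OF p sym[OF q]]]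
    and row2 = row_inner_le[OF A r s w(1)[OF s sym[OF r]] w(2)[OF s sym[OF r]]]
    and column1 = column_inner_le[OF A p r w(1)[OF sym[OF p] r] w(3)[OF sym[OF p] r]]
    and column2 = column_inner_le[OF A q s w(1)[OF sym[OF s] q] w(2)[OF sym[OF s] q]]

  have "cmod (A_inner ?D (op_matrix P Q R S z) z) \<le> min \<mu> \<nu>" if z: "A_seminorm ?D z = 1" for z
  proof -
    obtain x y where xy: "z = (x, y)" by (cases z)
    have one: "(A_seminorm A x)\<^sup>2 + (A_seminorm A y)\<^sup>2 = 1"
      using z op_matrix_diag_seminorm_sq[OF A, of x y] by (simp add: xy)
    have "(A_seminorm A x)\<^sup>2 \<le> 1\<^sup>2" "(A_seminorm A y)\<^sup>2 \<le> 1\<^sup>2"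
      using one zero_le_power2[of "A_seminorm A x"] zero_le_power2[of "A_seminorm A y"]
      unfolding one_power2 by linarith+
    then have x1: "A_seminorm A x \<le> 1" and y1: "A_seminorm A y \<le> 1"
      by (auto intro: power2_le_imp_le)
    \<comment> \<open>The same four terms, grouped by rows for \<open>\<mu>\<close> and by columns for \<open>\<nu>\<close>.\<close>
    have rows: "A_inner ?D (op_matrix P Q R S z) z
        = (A_inner A (P x) x + A_inner A (Q y) x) + (A_inner A (R x) y + A_inner A (S y) y)"
      by (simp add: xy op_matrix_def[of P] op_matrix_diag_inner[OF A] A_inner_simps[OF A])
    also have "\<dots> = (A_inner A (P x) x + A_inner A (R x) y) + (A_inner A (Q y) x + A_inner A (S y) y)"
      by (simp only: add_ac)
    finally have columns: "A_inner ?D (op_matrix P Q R S z) z = \<dots>" .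
    have "cmod (A_inner ?D (op_matrix P Q R S z) z) \<le> \<mu>"
      unfolding rows \<mu>_def by (rule norm_triangle_mono[OF row1[OF x1 one] row2[OF y1 one]])
    moreover have "cmod (A_inner ?D (op_matrix P Q R S z) z) \<le> \<nu>"
      unfolding columns \<nu>_def by (rule norm_triangle_mono[OF column1[OF x1 one] column2[OF y1 one]])
    ultimately show ?thesis by simp
  qed
  moreover have "0 \<le> min \<mu> \<nu>"
    unfolding \<mu>_def \<nu>_def
    using w(1)[OF p sym[OF q]] w(1)[OF s sym[OF r]] w(1)[OF sym[OF p] r] w(1)[OF sym[OF s] q]
    by simp
  ultimately show ?thesis by (intro A_numradius_le)
qed

end
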